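(* Let $0<\alpha\le1$, $c\ge0$, $a<b$ real, $\eta:\mathbb{R}^{\alpha}\times\mathbb{R}^{\alpha}\to\mathbb{R}^{\alpha}$, and let $f:[a,b]\to\mathbb{R}^{\alpha}$ be generalized strongly $\eta$-convex with respect to $\eta$ and modulus $c$. Suppose that $\eta(\cdot,\cdot)$ is bounded from above on $f([a,b])\times f([a,b])$, and that $w:[a,b]\to\mathbb{R}_{+}^{\alpha}$ is symmetric with respect to $\frac{a+b}{2}$ and $w\in I_{x}^{(\alpha)}[a,b]$; assume that the local fractional integrals appearing below exist. Then $$\begin{aligned} &f\left(\frac{a+b}{2}\right){}_{a}I_{b}^{(\alpha)}w(x)-L_{\eta}(a,b)+\frac{c^{\alpha}}{4^{\alpha}}\,{}_{a}I_{b}^{(\alpha)}(a+b-2x)^{2\alpha}w(x)\\ &\qquad\le {}_{a}I_{b}^{(\alpha)}f(x)w(x)\\ &\qquad\le \frac{f(a)+f(b)}{2^{\alpha}}\,{}_{a}I_{b}^{(\alpha)}w(x)+R_{\eta}(a,b)-c^{\alpha}\,{}_{a}I_{b}^{(\alpha)}(b-x)^{\alpha}(x-a)^{\alpha}w(x), \end{aligned}$$ where $$L_{\eta}(a,b):=\frac{1}{2^{\alpha}}\,{}_{a}I_{b}^{(\alpha)}\eta(f(a+b-x),f(x))w(x)$$ and $$R_{\eta}(a,b):=\frac{\eta(f(a),f(b))+\eta(f(b),f(a))}{2^{\alpha}(b-a)^{\alpha}}\,{}_{a}I_{b}^{(\alpha)}(b-x)^{\alpha}w(x).$$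
   Context: Fractal real numbers (Yang). For $0<\alpha\le1$, $\mathbb{R}^{\alpha}=\{a^{\alpha}: a\in\mathbb{R}\}$ is the set of $\alpha$-type real numbers (the union of the $\alpha$-type rationals $\mathbb{Q}^\alpha$ and $\alpha$-type irrationals $\mathbb{J}^\alpha$), where $a^\alpha$ is a symbol attached to the real number $a$. Its operations are $a^{\alpha}+b^{\alpha}=(a+b)^{\alpha}$ and $a^{\alpha}b^{\alpha}=(ab)^{\alpha}$; they are commutative and associative, multiplication distributes over addition, $0^{\alpha}$ is the additive and $1^{\alpha}$ the multiplicative identity. The order is $a^\alpha\le b^\alpha$ iff $a\le b$, and $\mathbb{R}_+^\alpha$ denotes the nonnegative elements of $\mathbb{R}^\alpha$. The element $(a^{2})^{\alpha}$ is written $a^{2\alpha}$. Values of the Gamma function $\Gamma$ appear as numerical factors. Generalized strongly $\eta$-convex function. A function $f:I=[a,b]\subset\mathbb{R}\to\mathbb{R}^{\alpha}$ is generalized strongly $\eta$-convex with respect to $\eta:\mathbb{R}^{\alpha}\times\mathbb{R}^{\alpha}\to\mathbb{R}^{\alpha}$ and modulus $c\ge0$ if $$f(tx+(1-t)y)\le f(y)+t^{\alpha}\eta(f(x),f(y))-c^{\alpha}t^{\alpha}(1-t)^{\alpha}(x-y)^{2\alpha}$$ for all $x,y\in I$ and $t\in[0,1]$. Symmetry. A function $w:[a,b]\to\mathbb{R}^{\alpha}$ is symmetric with respect to $\frac{a+b}{2}$ if $w(x)=w(a+b-x)$ for all $x\in[a,b]$. Local fractional integral. The local fractional integral of order $\alpha$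 of a function $g$ on $[a,b]$ (in Yang's local fractional calculus, introduced for local fractional continuous $g$) is $${}_{a}I_{b}^{(\alpha)}g(t)=\frac{1}{\Gamma(1+\alpha)}\int_a^b g(t)(dt)^{\alpha}=\frac{1}{\Gamma(1+\alpha)}\lim_{\Delta t\to0}\sum_{j=0}^{N-1}g(t_j)(\Delta t_j)^{\alpha},$$ where $a=t_0<t_1<\cdots<t_N=b$ is a partition of $[a,b]$, $\Delta t_j=t_{j+1}-t_j$ and $\Delta t=\max_j\Delta t_j$. Here $g$ is local fractional continuous at $x_0$ if for every $\varepsilon>0$ there is $\delta>0$ with $|g(x)-g(x_0)|<\varepsilon^{\alpha}$ whenever $|x-x_0|<\delta$. One sets ${}_{a}I_{a}^{(\alpha)}g=0$, and $g\in I_x^{(\alpha)}[a,b]$ means that ${}_{a}I_{x}^{(\alpha)}g$ exists for every $x\in[a,b]$. In an expression such as ${}_{a}I_{b}^{(\alpha)}f(x)w(x)$ the operator is applied to the whole product to its right as a function of $x\in[a,b]$. *)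

theory Defs
  imports "HOL-Analysis.Gamma_Function" "HOL-Library.FuncSet"
begin

text \<open>
  The symbol \<open>a\<^sup>\<alpha>\<close> is the pair of its base \<open>a\<close> and its order \<open>\<alpha>\<close>. It is a formal symbol, not the
  real power of \<open>a\<close>. All orders live in one type, and \<open>\<real>\<^sup>\<alpha>\<close> is the set of symbols of order \<open>\<alpha>\<close>;
  the operations below are meaningful only between symbols of equal order.
\<close>

datatype fractal = FPow (fbase: real) (forder: real)  (infixr "\<up>" 80)

definition fractals :: "real \<Rightarrow> fractal set" where
  "fractals \<alpha> = {a \<up> \<alpha> | a. True}"

instantiation fractal :: "{plus, minus, times, inverse, abs, order, scaleR}"
begin

definition "x + y = (if forder x = forder y then (fbase x + fbase y) \<up> forder x else undefined)"
definition "x - y = (if forder x = forder y then (fbase x - fbase y) \<up> forder x else undefined)"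
definition "x * y = (if forder x = forder y then (fbase x * fbase y) \<up> forder x else undefined)"
definition "x div y = (if forder x = forder y then (fbase x / fbase y) \<up> forder x else undefined)"
definition "inverse x = inverse (fbase x) \<up> forder x"
definition "\<bar>x\<bar> = \<bar>fbase x\<bar> \<up> forder x"
definition "x \<le> y \<longleftrightarrow> forder x = forder y \<and> fbase x \<le> fbase y"
definition "x < y \<longleftrightarrow> forder x = forder y \<and> fbase x < fbase y"

text \<open>
  A numerical factor \<open>r\<close> acts as multiplication by \<open>r\<close> on the base. This is the only order preserving
  real vector space structure on \<open>\<real>\<^sup>\<alpha>\<close>: the addition fixes the action of rational factors, as in
  \<open>2 a\<^sup>\<alpha> = a\<^sup>\<alpha> + a\<^sup>\<alpha> = (2 a)\<^sup>\<alpha>\<close>, and the order fixes the rest.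
\<close>

definition "r *\<^sub>R x = (r * fbase x) \<up> forder x" for x :: fractal

instance
  by standard (auto simp: less_eq_fractal_def less_fractal_def fractal.expand)

end

lemma FPow_simps [simp]:
  "a \<up> \<alpha> + b \<up> \<alpha> = (a + b) \<up> \<alpha>"
  "a \<up> \<alpha> - b \<up> \<alpha> = (a - b) \<up> \<alpha>"
  "a \<up> \<alpha> * b \<up> \<alpha> = (a * b) \<up> \<alpha>"
  "a \<up> \<alpha> / b \<up> \<alpha> = (a / b) \<up> \<alpha>"
  "inverse (a \<up> \<alpha>) = inverse a \<up> \<alpha>"
  "\<bar>a \<up> \<alpha>\<bar> = \<bar>a\<bar> \<up> \<alpha>"
  "a \<up> \<alpha> \<le> b \<up> \<alpha> \<longleftrightarrow> a \<le> b"
  "a \<up> \<alpha> < b \<up> \<alpha> \<longleftrightarrow> a < b"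
  "r *\<^sub>R (a \<up> \<alpha>) = (r * a) \<up> \<alpha>"
  by (simp_all add: plus_fractal_def minus_fractal_def times_fractal_def divide_fractal_def
      inverse_fractal_def abs_fractal_def less_eq_fractal_def less_fractal_def scaleR_fractal_def)

lemma FPow_in_fractals [simp]: "a \<up> \<alpha> \<in> fractals \<beta> \<longleftrightarrow> \<alpha> = \<beta>"
  by (auto simp: fractals_def)

definition nonneg_fractals :: "real \<Rightarrow> fractal set" where
  "nonneg_fractals \<alpha> = {x \<in> fractals \<alpha>. 0 \<up> \<alpha> \<le> x}"

text \<open>Big sums are not available on \<^typ>\<open>fractal\<close>, whose zero \<open>0\<^sup>\<alpha>\<close> depends on the order.\<close>

primrec fractal_sum :: "real \<Rightarrow> (nat \<Rightarrow> fractal) \<Rightarrow> nat \<Rightarrow> fractal" where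
  "fractal_sum \<alpha> g 0 = 0 \<up> \<alpha>"
| "fractal_sum \<alpha> g (Suc n) = fractal_sum \<alpha> g n + g n"

definition generalized_strongly_eta_convex ::
  "real \<Rightarrow> real \<Rightarrow> real \<Rightarrow> (fractal \<times> fractal \<Rightarrow> fractal) \<Rightarrow> real \<Rightarrow> (real \<Rightarrow> fractal) \<Rightarrow> bool" where
  "generalized_strongly_eta_convex \<alpha> a b \<eta> c f \<longleftrightarrow>
    (\<forall>x\<in>{a..b}. \<forall>y\<in>{a..b}. \<forall>t\<in>{0..1}.
      f (t * x + (1 - t) * y) \<le>
        f y + t \<up> \<alpha> * \<eta> (f x, f y) - c \<up> \<alpha> * t \<up> \<alpha> * (1 - t) \<up> \<alpha> * (x - y)\<^sup>2 \<up> \<alpha>)"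

definition symmetric_about_midpoint :: "real \<Rightarrow> real \<Rightarrow> (real \<Rightarrow> fractal) \<Rightarrow> bool" where
  "symmetric_about_midpoint a b w \<longleftrightarrow> (\<forall>x\<in>{a..b}. w x = w (a + b - x))"

definition partition_points :: "real \<Rightarrow> real \<Rightarrow> nat \<Rightarrow> (nat \<Rightarrow> real) \<Rightarrow> bool" where
  "partition_points a b N t \<longleftrightarrow> t 0 = a \<and> t N = b \<and> (\<forall>j<N. t j < t (Suc j))"

text \<open>\<open>lf_sum_limit \<alpha> a b g S\<close>: the sums over partitions tend to \<open>S\<close> as the mesh tends to \<open>0\<close>.\<close>

definition lf_sum_limit :: "real \<Rightarrow> real \<Rightarrow> real \<Rightarrow> (real \<Rightarrow> fractal) \<Rightarrow> fractal \<Rightarrow> bool" where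
  "lf_sum_limit \<alpha> a b g S \<longleftrightarrow> S \<in> fractals \<alpha> \<and>
    (\<forall>\<epsilon>>0. \<exists>\<delta>>0. \<forall>N t. partition_points a b N t \<and> (\<forall>j<N. t (Suc j) - t j < \<delta>) \<longrightarrow>
      \<bar>fractal_sum \<alpha> (\<lambda>j. g (t j) * (t (Suc j) - t j) \<up> \<alpha>) N - S\<bar> < \<epsilon> \<up> \<alpha>)"

definition lf_integrable :: "real \<Rightarrow> real \<Rightarrow> real \<Rightarrow> (real \<Rightarrow> fractal) \<Rightarrow> bool" where
  "lf_integrable \<alpha> a b g \<longleftrightarrow> a = b \<or> (\<exists>S. lf_sum_limit \<alpha> a b g S)"

definition lf_integral :: "real \<Rightarrow> real \<Rightarrow> real \<Rightarrow> (real \<Rightarrow> fractal) \<Rightarrow> fractal" where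
  "lf_integral \<alpha> a b g =
    (if a = b then 0 \<up> \<alpha> else (1 / Gamma (1 + \<alpha>)) *\<^sub>R (THE S. lf_sum_limit \<alpha> a b g S))"

definition lf_integrable_upto :: "real \<Rightarrow> real \<Rightarrow> real \<Rightarrow> (real \<Rightarrow> fractal) \<Rightarrow> bool" where
  "lf_integrable_upto \<alpha> a b g \<longleftrightarrow> (\<forall>x\<in>{a..b}. lf_integrable \<alpha> a x g)"

lemma ex_fine_partition_points:
  assumes "a < b" "0 < \<delta>"
  shows "\<exists>N t. partition_points a b N t \<and> (\<forall>j<N. t (Suc j) - t j < \<delta>)"
proof -
  obtain n :: nat where n: "(b - a) / \<delta> < real n"
    using reals_Archimedean2 by blast
  have n0: "0 < real n"
    using n assms by (meson diff_gt_0_iff_gt divide_pos_pos order_less_trans)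
  define t where "t j = a + real j * ((b - a) / real n)" for j
  have step: "t (Suc j) - t j = (b - a) / real n" for j
    by (simp add: t_def algebra_simps add_divide_distrib diff_divide_distrib)
  have pos: "0 < (b - a) / real n" using assms n0 by simp
  have "(b - a) / real n < \<delta>"
    using n n0 assms by (simp add: field_simps)
  moreover have "t j < t (Suc j)" for j
    using step[of j] pos by linarith
  then have "partition_points a b n t"
    using n0 by (auto simp: partition_points_def t_def)
  ultimately show ?thesis using step by metis
qed

lemma partition_points_mem:
  assumes "partition_points a b N t" "j \<le> N"
  shows "t j \<in> {a..b}"
proof -
  have up: "i \<le> k \<Longrightarrow> k \<le> N \<Longrightarrow> t i \<le> t k" for i k
  proof (induction rule: dec_induct)
    case (step m)
    have "t m < t (Suc m)" using assms(1) step by (simp add: partition_points_def)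
    then show ?case using step by simp
  qed simp
  show ?thesis
    using up[of 0 j] up[of j N] assms by (simp add: partition_points_def)
qed

lemma fractal_sum_closed:
  "(\<And>j. j < n \<Longrightarrow> g j \<in> fractals \<alpha>) \<Longrightarrow> fractal_sum \<alpha> g n \<in> fractals \<alpha>"
proof (induction n)
  case (Suc n)
  then have "fractal_sum \<alpha> g n \<in> fractals \<alpha>" "g n \<in> fractals \<alpha>" by auto
  then show ?case by (auto simp: fractals_def)
qed simp

lemma lf_sum_limit_unique:
  assumes "a < b" and g: "g \<in> {a..b} \<rightarrow> fractals \<alpha>"
    and S: "lf_sum_limit \<alpha> a b g S" and T: "lf_sum_limit \<alpha> a b g T"
  shows "S = T"
proof -
  obtain s u where s: "S = s \<up> \<alpha>" and u: "T = u \<up> \<alpha>"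
    using S T by (auto simp: lf_sum_limit_def fractals_def)
  have "\<bar>s - u\<bar> \<le> 0 + e" if "0 < e" for e
  proof -
    have e2: "0 < e / 2" using that by simp
    obtain d1 where d1: "d1 > 0" "\<And>N t. partition_points a b N t \<Longrightarrow> \<forall>j<N. t (Suc j) - t j < d1 \<Longrightarrow>
      \<bar>fractal_sum \<alpha> (\<lambda>j. g (t j) * (t (Suc j) - t j) \<up> \<alpha>) N - S\<bar> < (e / 2) \<up> \<alpha>"
      using S e2 unfolding lf_sum_limit_def by blast
    obtain d2 where d2: "d2 > 0" "\<And>N t. partition_points a b N t \<Longrightarrow> \<forall>j<N. t (Suc j) - t j < d2 \<Longrightarrow>
      \<bar>fractal_sum \<alpha> (\<lambda>j. g (t j) * (t (Suc j) - t j) \<up> \<alpha>) N - T\<bar> < (e / 2) \<up> \<alpha>"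
      using T e2 unfolding lf_sum_limit_def by blast
    obtain N t where p: "partition_points a b N t" "\<forall>j<N. t (Suc j) - t j < min d1 d2"
      using ex_fine_partition_points[OF \<open>a < b\<close>, of "min d1 d2"] d1(1) d2(1) by auto
    define X where "X = fractal_sum \<alpha> (\<lambda>j. g (t j) * (t (Suc j) - t j) \<up> \<alpha>) N"
    have "g (t j) * (t (Suc j) - t j) \<up> \<alpha> \<in> fractals \<alpha>" if "j < N" for j
    proof -
      have "g (t j) \<in> fractals \<alpha>"
        using g partition_points_mem[OF p(1), of j] that by (auto simp: Pi_iff)
      then show ?thesis by (auto simp: fractals_def)
    qed
    then have "X \<in> fractals \<alpha>" unfolding X_def by (rule fractal_sum_closed)
    then obtain x where x: "X = x \<up> \<alpha>" by (auto simp: fractals_def)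
    have "\<bar>X - S\<bar> < (e / 2) \<up> \<alpha>" "\<bar>X - T\<bar> < (e / 2) \<up> \<alpha>"
      using d1(2)[OF p(1)] d2(2)[OF p(1)] p(2) by (auto simp: X_def)
    then have "\<bar>x - s\<bar> < e / 2" "\<bar>x - u\<bar> < e / 2" using s u x by simp_all
    then show ?thesis by linarith
  qed
  then have "\<bar>s - u\<bar> \<le> 0" by (rule field_le_epsilon)
  then show ?thesis using s u by simp
qed

definition L_eta ::
  "real \<Rightarrow> (fractal \<times> fractal \<Rightarrow> fractal) \<Rightarrow> (real \<Rightarrow> fractal) \<Rightarrow> (real \<Rightarrow> fractal) \<Rightarrow> real \<Rightarrow> real \<Rightarrow> fractal" where
  "L_eta \<alpha> \<eta> f w a b =
    1 \<up> \<alpha> / 2 \<up> \<alpha> * lf_integral \<alpha> a b (\<lambda>x. \<eta> (f (a + b - x), f x) * w x)"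

definition R_eta ::
  "real \<Rightarrow> (fractal \<times> fractal \<Rightarrow> fractal) \<Rightarrow> (real \<Rightarrow> fractal) \<Rightarrow> (real \<Rightarrow> fractal) \<Rightarrow> real \<Rightarrow> real \<Rightarrow> fractal" where
  "R_eta \<alpha> \<eta> f w a b =
    (\<eta> (f a, f b) + \<eta> (f b, f a)) / (2 \<up> \<alpha> * (b - a) \<up> \<alpha>) *
      lf_integral \<alpha> a b (\<lambda>x. (b - x) \<up> \<alpha> * w x)"

end

(* On bases, local fractional integrals are limits of left endpoint sums, so they may be computed
   along uniform partitions. The left inequality is the convexity inequality at t = 1/2 for the points
   a + b - x and x, multiplied by w(x) and integrated. The right one averages the convexity
   inequalities for x seen as a point between a and b in both orders. The moments of w against b - x
   and x - a agree because the left endpoint sum of a function that is odd about the midpoint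
   telescopes, over a uniform partition, to a boundary term that vanishes with the mesh. *)
theory Submission
  imports Defs
begin

lemma fractals_eq_FPow: "x \<in> fractals \<alpha> \<Longrightarrow> x = fbase x \<up> \<alpha>"
  by (auto simp: fractals_def)

text \<open>Uniform partitions suffice because existence of every integral is assumed. For
  \<open>n = 0\<close> division by zero makes the sum \<open>0\<close>, so linearity and
  monotonicity hold for all \<open>n\<close>.\<close>

definition uniform_sum :: "real \<Rightarrow> real \<Rightarrow> (real \<Rightarrow> real) \<Rightarrow> nat \<Rightarrow> real" where
  "uniform_sum a b g n = (\<Sum>j<n. g (a + real j * ((b - a) / real n))) * ((b - a) / real n)"

lemma uniform_sum_linear:
  "uniform_sum a b (\<lambda>x. g x + h x) n = uniform_sum a b g n + uniform_sum a b h n"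
  "uniform_sum a b (\<lambda>x. g x - h x) n = uniform_sum a b g n - uniform_sum a b h n"
  "uniform_sum a b (\<lambda>x. k * g x) n = k * uniform_sum a b g n"
  by (simp_all add: uniform_sum_def sum.distrib sum_subtractf sum_distrib_left[symmetric]
      algebra_simps)

lemma uniform_partition_point_mem:
  assumes "a < b" "j \<le> n"
  shows "a + real j * ((b - a) / real n) \<in> {a..b}"
proof (cases "n = 0")
  case False
  have "real j * ((b - a) / real n) \<le> real n * ((b - a) / real n)"
    using assms by (intro mult_right_mono) auto
  with False assms show ?thesis by simp
qed (use assms in auto)

lemma uniform_sum_mono:
  assumes "a < b" "\<And>x. x \<in> {a..b} \<Longrightarrow> g x \<le> h x"
  shows "uniform_sum a b g n \<le> uniform_sum a b h n"
  unfolding uniform_sum_def using assms uniform_partition_point_mem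
  by (intro mult_right_mono sum_mono) auto

lemma partition_points_uniform:
  assumes "a < b" "0 < n"
  shows "partition_points a b n (\<lambda>j. a + real j * ((b - a) / real n))"
  using assms by (auto simp: partition_points_def field_simps)

lemma fractal_sum_FPow:
  "(\<And>j. j < n \<Longrightarrow> h j = g j \<up> \<alpha>) \<Longrightarrow> fractal_sum \<alpha> h n = (\<Sum>j<n. g j) \<up> \<alpha>"
  by (induction n) auto

text \<open>The uniform partition into \<open>n\<close> parts has mesh \<open>(b - a) / n\<close>,
  which falls below any \<delta>, so a limit over all partitions is also the limit along this
  sequence.\<close>

lemma lf_sum_limit_uniform_sum:
  assumes "a < b" and h: "\<And>x. x \<in> {a..b} \<Longrightarrow> h x = g x \<up> \<alpha>"
    and "lf_sum_limit \<alpha> a b h (s \<up> \<alpha>)"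
  shows "uniform_sum a b g \<longlonglongrightarrow> s"
proof (rule LIMSEQ_I)
  fix e :: real assume "0 < e"
  then obtain d where d: "d > 0" "\<And>N t. partition_points a b N t \<Longrightarrow> \<forall>j<N. t (Suc j) - t j < d \<Longrightarrow>
      \<bar>fractal_sum \<alpha> (\<lambda>j. h (t j) * (t (Suc j) - t j) \<up> \<alpha>) N - s \<up> \<alpha>\<bar> < e \<up> \<alpha>"
    using assms(3) unfolding lf_sum_limit_def by blast
  obtain n0 :: nat where n0: "(b - a) / d < real n0"
    using reals_Archimedean2 by blast
  \<comment> \<open>\<open>Suc n0\<close> makes \<open>n\<close> visibly positive, so division by
    \<open>n\<close> is genuine.\<close>
  have "norm (uniform_sum a b g n - s) < e" if "Suc n0 \<le> n" for n
  proof -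
    define t where "t j = a + real j * ((b - a) / real n)" for j
    have step: "t (Suc j) - t j = (b - a) / real n" for j
      by (simp add: t_def algebra_simps add_divide_distrib diff_divide_distrib)
    have part: "partition_points a b n t"
      unfolding t_def using \<open>a < b\<close> that by (intro partition_points_uniform) auto
    have "(b - a) / d < real n" using n0 that by linarith
    then have fine: "(b - a) / real n < d"
      using d(1) that by (simp add: field_simps)
    have "fractal_sum \<alpha> (\<lambda>j. h (t j) * (t (Suc j) - t j) \<up> \<alpha>) n
        = (\<Sum>j<n. g (t j) * ((b - a) / real n)) \<up> \<alpha>"
      using h partition_points_mem[OF part] by (intro fractal_sum_FPow) (simp add: step)
    also have "\<dots> = uniform_sum a b g n \<up> \<alpha>"
      by (simp only: uniform_sum_def t_def sum_distrib_right)
    finally show ?thesis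
      using d(2)[OF part] fine by (simp add: step)
  qed
  then show "\<exists>n0. \<forall>n\<ge>n0. norm (uniform_sum a b g n - s) < e" by blast
qed

text \<open>Uniqueness of the limit identifies the definite description with a given limit. The
  positive factor \<open>Gamma (1 + \<alpha>)\<close> stays on the side of the sums and is cancelled
  once two limits have been compared.\<close>

lemma lf_integral_eq_FPow:
  assumes "a < b" "0 < \<alpha>" and h: "\<And>x. x \<in> {a..b} \<Longrightarrow> h x = g x \<up> \<alpha>"
    and "lf_integrable \<alpha> a b h"
  obtains I where "lf_integral \<alpha> a b h = I \<up> \<alpha>" "uniform_sum a b g \<longlonglongrightarrow> Gamma (1 + \<alpha>) * I"
proof -
  obtain S where S: "lf_sum_limit \<alpha> a b h S"
    using assms by (auto simp: lf_integrable_def)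
  then obtain s where s: "S = s \<up> \<alpha>"
    by (auto simp: lf_sum_limit_def fractals_def)
  have "(THE T. lf_sum_limit \<alpha> a b h T) = S"
    using S h by (intro the_equality lf_sum_limit_unique[OF \<open>a < b\<close>]) auto
  then have "lf_integral \<alpha> a b h = (s / Gamma (1 + \<alpha>)) \<up> \<alpha>"
    using \<open>a < b\<close> by (simp add: lf_integral_def s)
  moreover have "Gamma (1 + \<alpha>) > 0"
    using \<open>0 < \<alpha>\<close> by (intro Gamma_real_pos) simp
  ultimately show thesis
    using that lf_sum_limit_uniform_sum[OF \<open>a < b\<close> h] S s by auto
qed

text \<open>Reflection maps the uniform partition to itself, so the values of an odd function at all
  \<open>n + 1\<close> points add up to \<open>0\<close>. The left endpoint sum omits only the point
  \<open>b\<close>, which leaves \<open>- h b\<close> times the step.\<close>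

lemma uniform_sum_odd_tendsto_0:
  assumes "a < b" and odd: "\<And>x. x \<in> {a..b} \<Longrightarrow> h (a + b - x) = - h x"
  shows "uniform_sum a b h \<longlonglongrightarrow> 0"
proof -
  have "uniform_sum a b h n = - h b * (b - a) / real n" for n
  proof (cases "n = 0")
    case False
    define t where "t j = a + real j * ((b - a) / real n)" for j
    have refl: "t (n - j) = a + b - t j" if "j \<le> n" for j
      using that False by (simp add: t_def of_nat_diff field_simps)
    have "(\<Sum>j\<le>n. h (t j)) = (\<Sum>j\<le>n. h (t (n - j)))"
      by (rule sum.reindex_bij_witness[of _ "\<lambda>j. n - j" "\<lambda>j. n - j"]) auto
    also have "\<dots> = - (\<Sum>j\<le>n. h (t j))"
      using odd uniform_partition_point_mem[OF \<open>a < b\<close>, of _ n, folded t_def]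
      unfolding sum_negf[symmetric] by (intro sum.cong) (simp_all add: refl)
    finally have "(\<Sum>j<n. h (t j)) + h (t n) = 0"
      by (simp add: lessThan_Suc_atMost[symmetric])
    moreover have "t n = b" using False by (simp add: t_def)
    ultimately have "(\<Sum>j<n. h (t j)) = - h b" by (simp add: eq_neg_iff_add_eq_0)
    then show ?thesis by (simp add: uniform_sum_def t_def)
  qed (simp add: uniform_sum_def)
  then show ?thesis
    using lim_const_over_n[of "- h b * (b - a)"] by presburger
qed

theorem theorem2p8:
  fixes \<alpha> c a b :: real
    and \<eta> :: "fractal \<times> fractal \<Rightarrow> fractal"
    and f w :: "real \<Rightarrow> fractal"
  assumes "0 < \<alpha>" and "\<alpha> \<le> 1" and "0 \<le> c" and "a < b"
    and "\<eta> \<in> fractals \<alpha> \<times> fractals \<alpha> \<rightarrow> fractals \<alpha>"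
    and "f \<in> {a..b} \<rightarrow> fractals \<alpha>"
    and "generalized_strongly_eta_convex \<alpha> a b \<eta> c f"
    and "\<exists>M\<in>fractals \<alpha>. \<forall>p \<in> f ` {a..b} \<times> f ` {a..b}. \<eta> p \<le> M"
    and "w \<in> {a..b} \<rightarrow> nonneg_fractals \<alpha>"
    and "symmetric_about_midpoint a b w"
    and "lf_integrable_upto \<alpha> a b w"
    and "lf_integrable \<alpha> a b (\<lambda>x. \<eta> (f (a + b - x), f x) * w x)"
    and "lf_integrable \<alpha> a b (\<lambda>x. (a + b - 2 * x)\<^sup>2 \<up> \<alpha> * w x)"
    and "lf_integrable \<alpha> a b (\<lambda>x. f x * w x)"
    and "lf_integrable \<alpha> a b (\<lambda>x. (b - x) \<up> \<alpha> * w x)"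
    and "lf_integrable \<alpha> a b (\<lambda>x. (b - x) \<up> \<alpha> * (x - a) \<up> \<alpha> * w x)"
  shows "f ((a + b) / 2) * lf_integral \<alpha> a b w - L_eta \<alpha> \<eta> f w a b
           + c \<up> \<alpha> / 4 \<up> \<alpha> * lf_integral \<alpha> a b (\<lambda>x. (a + b - 2 * x)\<^sup>2 \<up> \<alpha> * w x)
         \<le> lf_integral \<alpha> a b (\<lambda>x. f x * w x)
       \<and> lf_integral \<alpha> a b (\<lambda>x. f x * w x)
         \<le> (f a + f b) / 2 \<up> \<alpha> * lf_integral \<alpha> a b w + R_eta \<alpha> \<eta> f w a b
           - c \<up> \<alpha> * lf_integral \<alpha> a b (\<lambda>x. (b - x) \<up> \<alpha> * (x - a) \<up> \<alpha> * w x)"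
proof -
  define F where "F x = fbase (f x)" for x
  define W where "W x = fbase (w x)" for x
  define E where "E x y = fbase (\<eta> (f x, f y))" for x y
  have f: "f x = F x \<up> \<alpha>" if "x \<in> {a..b}" for x
    unfolding F_def using that assms(6) by (intro fractals_eq_FPow) auto
  have w: "w x = W x \<up> \<alpha>" and W_nonneg: "0 \<le> W x" if "x \<in> {a..b}" for x
  proof -
    have *: "w x \<in> fractals \<alpha>" "0 \<up> \<alpha> \<le> w x"
      using that assms(9) by (auto simp: nonneg_fractals_def)
    show "w x = W x \<up> \<alpha>" unfolding W_def using *(1) by (rule fractals_eq_FPow)
    then show "0 \<le> W x" using *(2) by simp
  qed
  \<comment> \<open>The arguments are given through \<open>F\<close>, since the simplifier rewrites
    \<open>f x\<close> by \<open>f\<close> before this rule can fire.\<close>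
  have eta: "\<eta> (F x \<up> \<alpha>, F y \<up> \<alpha>) = E x y \<up> \<alpha>" if "x \<in> {a..b}" "y \<in> {a..b}" for x y
    unfolding E_def f[OF that(1)] f[OF that(2)] using assms(5) by (intro fractals_eq_FPow) auto
  have W_sym: "W (a + b - x) = W x" if "x \<in> {a..b}" for x
    using assms(10) that unfolding symmetric_about_midpoint_def W_def by metis
  have convex: "F (t * x + (1 - t) * y) \<le> F y + t * E x y - c * t * (1 - t) * (x - y)\<^sup>2"
    if "x \<in> {a..b}" "y \<in> {a..b}" "t \<in> {0..1}" for x y t
  proof -
    \<comment> \<open>The left side of the convexity inequality can be moved to bases only at a
      point of the interval.\<close>
    have "t * x + (1 - t) * y \<in> {a..b}"
      using convexD[OF convex_real_interval(5), of x a b y t "1 - t"] that by simp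
    moreover have "f (t * x + (1 - t) * y) \<le>
        f y + t \<up> \<alpha> * \<eta> (f x, f y) - c \<up> \<alpha> * t \<up> \<alpha> * (1 - t) \<up> \<alpha> * (x - y)\<^sup>2 \<up> \<alpha>"
      using assms(7) that by (simp add: generalized_strongly_eta_convex_def)
    ultimately show ?thesis using that by (simp add: f eta)
  qed

  note integral = lf_integral_eq_FPow[OF \<open>a < b\<close> \<open>0 < \<alpha>\<close>]
  have w_int: "lf_integrable \<alpha> a b w"
    using assms(4,11) by (simp add: lf_integrable_upto_def)
  obtain Iw where Iw: "lf_integral \<alpha> a b w = Iw \<up> \<alpha>"
      "uniform_sum a b W \<longlonglongrightarrow> Gamma (1 + \<alpha>) * Iw"
    by (rule integral[OF _ w_int, where g = W]) (simp_all add: w)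
  obtain Ie where Ie: "lf_integral \<alpha> a b (\<lambda>x. \<eta> (f (a + b - x), f x) * w x) = Ie \<up> \<alpha>"
      "uniform_sum a b (\<lambda>x. E (a + b - x) x * W x) \<longlonglongrightarrow> Gamma (1 + \<alpha>) * Ie"
    by (rule integral[OF _ assms(12), where g = "\<lambda>x. E (a + b - x) x * W x"]) (simp_all add: f eta w)
  obtain Iq where Iq: "lf_integral \<alpha> a b (\<lambda>x. (a + b - 2 * x)\<^sup>2 \<up> \<alpha> * w x) = Iq \<up> \<alpha>"
      "uniform_sum a b (\<lambda>x. (a + b - 2 * x)\<^sup>2 * W x) \<longlonglongrightarrow> Gamma (1 + \<alpha>) * Iq"
    by (rule integral[OF _ assms(13), where g = "\<lambda>x. (a + b - 2 * x)\<^sup>2 * W x"]) (simp_all add: w)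
  obtain If where If: "lf_integral \<alpha> a b (\<lambda>x. f x * w x) = If \<up> \<alpha>"
      "uniform_sum a b (\<lambda>x. F x * W x) \<longlonglongrightarrow> Gamma (1 + \<alpha>) * If"
    by (rule integral[OF _ assms(14), where g = "\<lambda>x. F x * W x"]) (simp_all add: f w)
  obtain Ib where Ib: "lf_integral \<alpha> a b (\<lambda>x. (b - x) \<up> \<alpha> * w x) = Ib \<up> \<alpha>"
      "uniform_sum a b (\<lambda>x. (b - x) * W x) \<longlonglongrightarrow> Gamma (1 + \<alpha>) * Ib"
    by (rule integral[OF _ assms(15), where g = "\<lambda>x. (b - x) * W x"]) (simp_all add: w)
  obtain Ip where Ip: "lf_integral \<alpha> a b (\<lambda>x. (b - x) \<up> \<alpha> * (x - a) \<up> \<alpha> * w x) = Ip \<up> \<alpha>"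
      "uniform_sum a b (\<lambda>x. (b - x) * (x - a) * W x) \<longlonglongrightarrow> Gamma (1 + \<alpha>) * Ip"
    by (rule integral[OF _ assms(16), where g = "\<lambda>x. (b - x) * (x - a) * W x"]) (simp_all add: w)
  \<comment> \<open>The weight \<open>2 * x - a - b\<close> is the difference of
    \<open>x - a\<close> and \<open>b - x\<close>. It is odd about the midpoint and \<open>W\<close>
    is even there.\<close>
  have odd: "uniform_sum a b (\<lambda>x. (2 * x - a - b) * W x) \<longlonglongrightarrow> 0"
    using \<open>a < b\<close> by (rule uniform_sum_odd_tendsto_0) (simp add: W_sym algebra_simps)
  have Gamma_pos: "Gamma (1 + \<alpha>) > 0"
    using \<open>0 < \<alpha>\<close> by (intro Gamma_real_pos) simp

  \<comment> \<open>At \<open>t = 1 / 2\<close> the factor \<open>t * (1 - t)\<close> is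
    \<open>1 / 4\<close>, and the two points differ by \<open>a + b - 2 * x\<close>.\<close>
  have lower: "F ((a + b) / 2) * W x - 1 / 2 * (E (a + b - x) x * W x)
      + c / 4 * ((a + b - 2 * x)\<^sup>2 * W x) \<le> F x * W x" if "x \<in> {a..b}" for x
  proof -
    have mid: "(a + b - x) / 2 + x / 2 = (a + b) / 2"
      by (simp add: add_divide_distrib[symmetric])
    have "F ((a + b) / 2) - 1 / 2 * E (a + b - x) x + c / 4 * (a + b - 2 * x)\<^sup>2 \<le> F x"
      using convex[of "a + b - x" x "1 / 2"] that by (simp add: mid)
    from mult_right_mono[OF this W_nonneg[OF that]] show ?thesis
      by (simp add: algebra_simps)
  qed
  have "F ((a + b) / 2) * (Gamma (1 + \<alpha>) * Iw) - 1 / 2 * (Gamma (1 + \<alpha>) * Ie)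
      + c / 4 * (Gamma (1 + \<alpha>) * Iq) \<le> Gamma (1 + \<alpha>) * If"
  \<comment> \<open>The pointwise bound holds for the sums at every \<open>n\<close>; linearity
    splits them into sums with known limits.\<close>
  proof (rule LIMSEQ_le)
    show "(\<lambda>n. F ((a + b) / 2) * uniform_sum a b W n
          - 1 / 2 * uniform_sum a b (\<lambda>x. E (a + b - x) x * W x) n
          + c / 4 * uniform_sum a b (\<lambda>x. (a + b - 2 * x)\<^sup>2 * W x) n)
        \<longlonglongrightarrow> F ((a + b) / 2) * (Gamma (1 + \<alpha>) * Iw) - 1 / 2 * (Gamma (1 + \<alpha>) * Ie)
          + c / 4 * (Gamma (1 + \<alpha>) * Iq)"
      by (intro tendsto_intros Iw Ie Iq)
  qed (use If uniform_sum_mono[OF \<open>a < b\<close> lower] in \<open>auto simp only: uniform_sum_linear\<close>)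
  then have "Gamma (1 + \<alpha>) * (F ((a + b) / 2) * Iw - Ie / 2 + c / 4 * Iq) \<le> Gamma (1 + \<alpha>) * If"
    by (simp add: algebra_simps)
  then have left: "F ((a + b) / 2) * Iw - Ie / 2 + c / 4 * Iq \<le> If"
    using Gamma_pos by simp

  \<comment> \<open>This is the base of the denominator of \<open>R_eta\<close>, inverted.\<close>
  define k where "k = 1 / (2 * (b - a))"
  have upper: "F x * W x \<le> (F a + F b) / 2 * W x + k * (E a b + E b a) * ((b - x) * W x)
      + k * E b a * ((2 * x - a - b) * W x) - c * ((b - x) * (x - a) * W x)"
    if "x \<in> {a..b}" for x
  proof -
    \<comment> \<open>This is the weight of \<open>a\<close> when \<open>x\<close> is written as a
      convex combination of \<open>a\<close> and \<open>b\<close>.\<close>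
    define t where "t = (b - x) / (b - a)"
    have t: "t \<in> {0..1}" and t': "1 - t \<in> {0..1}"
      using that \<open>a < b\<close> by (auto simp: t_def field_simps)
    have tb: "t * (b - a) = b - x" using \<open>a < b\<close> by (simp add: t_def)
    then have x: "t * a + (1 - t) * b = x" by (simp add: algebra_simps)
    have "t * (1 - t) * (b - a)\<^sup>2 = (t * (b - a)) * ((b - a) - t * (b - a))"
      by (simp add: power2_eq_square algebra_simps)
    then have prod: "t * (1 - t) * (b - a)\<^sup>2 = (b - x) * (x - a)"
      by (simp add: tb)
    have t_half: "t / 2 = k * (b - x)" by (simp add: t_def k_def)
    have "k * (b - a) = 1 / 2" using \<open>a < b\<close> by (simp add: k_def)
    \<comment> \<open>The weight of \<open>E b a\<close> is \<open>k * (x - a)\<close>. It is split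
      into \<open>k * (b - x)\<close>, the weight of \<open>E a b\<close>, and an odd
      remainder.\<close>
    then have "(1 - t) / 2 = k * (b - a) - k * (b - x)"
      using t_half by (simp add: diff_divide_distrib)
    also have "\<dots> = k * (b - x) + k * (2 * x - a - b)" by (simp add: algebra_simps)
    finally have t'_half: "(1 - t) / 2 = k * (b - x) + k * (2 * x - a - b)" .
    have "F x \<le> F b + t * E a b - c * ((b - x) * (x - a))"
      using convex[of a b t] t \<open>a < b\<close> by (simp add: x prod[symmetric] power2_commute mult.assoc)
    \<comment> \<open>Exchanging the endpoints along with \<open>t\<close> and \<open>1 - t\<close>
      describes the same point \<open>x\<close> and keeps the modulus term.\<close>
    moreover have "F x \<le> F a + (1 - t) * E b a - c * ((b - x) * (x - a))"
      using convex[of b a "1 - t"] t' \<open>a < b\<close> x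
      by (simp add: prod[symmetric] mult_ac add.commute)
    ultimately have "F x \<le> (F a + F b) / 2 + t / 2 * E a b + (1 - t) / 2 * E b a
        - c * ((b - x) * (x - a))" by (simp add: field_simps)
    from mult_right_mono[OF this W_nonneg[OF that]] show ?thesis
      unfolding t_half t'_half by (simp add: algebra_simps)
  qed
  \<comment> \<open>The summand with factor \<open>0\<close> is the limit of the odd remainder, so
    both values of \<eta> end up with the same moment \<open>Ib\<close>.\<close>
  have "Gamma (1 + \<alpha>) * If \<le> (F a + F b) / 2 * (Gamma (1 + \<alpha>) * Iw)
      + k * (E a b + E b a) * (Gamma (1 + \<alpha>) * Ib) + k * E b a * 0 - c * (Gamma (1 + \<alpha>) * Ip)"
  proof (rule LIMSEQ_le)
    show "(\<lambda>n. (F a + F b) / 2 * uniform_sum a b W n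
          + k * (E a b + E b a) * uniform_sum a b (\<lambda>x. (b - x) * W x) n
          + k * E b a * uniform_sum a b (\<lambda>x. (2 * x - a - b) * W x) n
          - c * uniform_sum a b (\<lambda>x. (b - x) * (x - a) * W x) n)
        \<longlonglongrightarrow> (F a + F b) / 2 * (Gamma (1 + \<alpha>) * Iw)
          + k * (E a b + E b a) * (Gamma (1 + \<alpha>) * Ib) + k * E b a * 0 - c * (Gamma (1 + \<alpha>) * Ip)"
      by (intro tendsto_intros Iw Ib Ip odd)
  qed (use If uniform_sum_mono[OF \<open>a < b\<close> upper] in \<open>auto simp only: uniform_sum_linear\<close>)
  then have "Gamma (1 + \<alpha>) * If
      \<le> Gamma (1 + \<alpha>) * ((F a + F b) / 2 * Iw + k * (E a b + E b a) * Ib - c * Ip)"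
    by (simp add: algebra_simps)
  then have right: "If \<le> (F a + F b) / 2 * Iw + k * (E a b + E b a) * Ib - c * Ip"
    using Gamma_pos by simp

  show ?thesis
    using left right \<open>a < b\<close>
    unfolding L_eta_def R_eta_def Iw(1) Ie(1) Iq(1) If(1) Ib(1) Ip(1)
    by (simp add: f eta k_def)
qed

end
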